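(* Suppose $2\leq k\leq n$ are integers and $f:V(C_n)\to\{1,\ldots,k\}$ is a $k$-color weak maximizer of $W$ on $C_n$. (1) If $n$ is even and $n-k\leq2$, then $W(f)=\max\{W(f') : f'\in\mathrm{WM}_k(C_n)\}$. (2) Otherwise, i.e. if $n$ is odd or $n-k>2$, then $W(f)=\max\{W(f') : f'\in\mathrm{WM}_k(C_n)\}$ if and only if $f$ has a color class of the largest possible size $n-(k-1)$.
   Context: $C_n$ is the cycle on $n$ vertices (vertices $0,\ldots,n-1$, with distinct vertices $i,j$ adjacent iff $i-j\equiv\pm1\pmod n$). For a finite simple connected graph $G$ and $A\subseteq V(G)$, $W(A)=\sum_{\{u,v\}\in\binom{A}{2}}d_G(u,v)$, with $d_G$ the shortest-path distance. A $k$-coloring of $G$ is any function $f:V(G)\to\{1,\ldots,k\}$; its color classes are the sets $f^{-1}(i)$, $1\leq i\leq k$; $\mathrm{type}(f)$ is the $k$-tuple of the cardinalities $|f^{-1}(1)|,\ldots,|f^{-1}(k)|$ arranged in non-decreasing order, and $W(f)=\sum_{i=1}^k W(f^{-1}(i))$. For $k\geq 2$, $f$ is a $k$-color weak maximizer of $W$ on $G$ if $f$ is surjective and $W(f)\geq W(f')$ for all surjective $f':V(G)\to\{1,\ldots,k\}$ with $\mathrm{type}(f')=\mathrm{type}(f)$. $\mathrm{WM}_k(G)$ is the set of all $k$-color weak maximizers of $W$ on $G$. *)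

theory Defs
  imports "Graph_Theory.Graph_Theory" "HOL-Number_Theory.Cong" "HOL-Library.FuncSet"
begin

text \<open>
  Undirected simple graphs are represented, as in the locale \<open>pair_graph\<close>, by symmetric
  loop-free digraphs whose arcs are pairs of vertices.
\<close>

definition cycle_graph :: "nat \<Rightarrow> nat pair_pre_digraph" where
  "cycle_graph n =
    \<lparr> pverts = {0..<n},
      parcs = {(i, j). i \<in> {0..<n} \<and> j \<in> {0..<n} \<and> i \<noteq> j \<and>
        ([int i - int j = 1] (mod int n) \<or> [int i - int j = - 1] (mod int n))} \<rparr>"

text \<open>The \<open>LEAST\<close> is only meaningful for \<open>v\<close> reachable from \<open>u\<close>; see \<open>\<mu>_eq_graph_dist\<close>.\<close>

definition graph_dist :: "'a pair_pre_digraph \<Rightarrow> 'a \<Rightarrow> 'a \<Rightarrow> nat" where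
  "graph_dist G u v = (LEAST l. \<exists>p. pre_digraph.apath (with_proj G) u p v \<and> length p = l)"

text \<open>
  The sum ranges over unordered pairs \<open>e = {u, v}\<close> of distinct vertices. The description
  is well defined because \<open>graph_dist\<close> is symmetric (\<open>graph_dist_commute\<close>).
\<close>

definition wiener :: "'a pair_pre_digraph \<Rightarrow> 'a set \<Rightarrow> nat" where
  "wiener G A =
    (\<Sum>e \<in> {e. e \<subseteq> A \<and> card e = 2}. THE d. \<forall>u v. e = {u, v} \<longrightarrow> d = graph_dist G u v)"

text \<open>
  Colorings are extensional, so that they correspond exactly to the functions from
  the vertex set to \<open>{1..k}\<close>.
\<close>

definition colorings :: "nat \<Rightarrow> 'a pair_pre_digraph \<Rightarrow> ('a \<Rightarrow> nat) set" where
  "colorings k G = pverts G \<rightarrow>\<^sub>E {1..k}"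

definition color_class :: "'a pair_pre_digraph \<Rightarrow> ('a \<Rightarrow> nat) \<Rightarrow> nat \<Rightarrow> 'a set" where
  "color_class G f i = {v \<in> pverts G. f v = i}"

definition coloring_type :: "nat \<Rightarrow> 'a pair_pre_digraph \<Rightarrow> ('a \<Rightarrow> nat) \<Rightarrow> nat list" where
  "coloring_type k G f = sort (map (\<lambda>i. card (color_class G f i)) [1..<Suc k])"

definition coloring_wiener :: "nat \<Rightarrow> 'a pair_pre_digraph \<Rightarrow> ('a \<Rightarrow> nat) \<Rightarrow> nat" where
  "coloring_wiener k G f = (\<Sum>i = 1..k. wiener G (color_class G f i))"

definition surj_colorings :: "nat \<Rightarrow> 'a pair_pre_digraph \<Rightarrow> ('a \<Rightarrow> nat) set" where
  "surj_colorings k G = {f \<in> colorings k G. f ` pverts G = {1..k}}"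

definition weak_maximizers :: "nat \<Rightarrow> 'a pair_pre_digraph \<Rightarrow> ('a \<Rightarrow> nat) set" where
  "weak_maximizers k G =
    {f \<in> surj_colorings k G. \<forall>f' \<in> surj_colorings k G.
       coloring_type k G f' = coloring_type k G f \<longrightarrow>
       coloring_wiener k G f' \<le> coloring_wiener k G f}"

lemma pair_graph_cycle_graph: "pair_graph (cycle_graph n)"
proof -
  have "finite (parcs (cycle_graph n))"
    by (rule finite_subset[of _ "{0..<n} \<times> {0..<n}"]) (auto simp: cycle_graph_def)
  moreover have "sym (parcs (cycle_graph n))"
  proof (rule symI)
    fix i j assume *: "(i, j) \<in> parcs (cycle_graph n)"
    have "[int j - int i = - c] (mod int n)" if "[int i - int j = c] (mod int n)" for c
      using that cong_minus_minus_iff[of "int i - int j" c "int n"] by simp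
    from this[of 1] this[of "- 1"] * show "(j, i) \<in> parcs (cycle_graph n)"
      by (auto simp: cycle_graph_def)
  qed
  ultimately show ?thesis
    by unfold_locales (auto simp: cycle_graph_def symmetric_def)
qed

lemma connected_cycle_graph:
  assumes "n \<ge> 1"
  shows "strongly_connected (with_proj (cycle_graph n))"
proof -
  interpret pair_graph "cycle_graph n" by (rule pair_graph_cycle_graph)
  have reach: "0 \<rightarrow>\<^sup>*\<^bsub>with_proj (cycle_graph n)\<^esub> i" if "i < n" for i
    using that
  proof (induction i)
    case 0
    then show ?case using assms by (intro reachable_refl) (auto simp: cycle_graph_def)
  next
    case (Suc i)
    have "(i, Suc i) \<in> parcs (cycle_graph n)"
      using Suc.prems by (auto simp: cycle_graph_def)
    then have "i \<rightarrow>\<^bsub>with_proj (cycle_graph n)\<^esub> Suc i" by simp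
    with Suc show ?case using reachable_adj_trans[of 0 i "Suc i"] by simp
  qed
  show ?thesis
  proof (rule strongly_connectedI)
    show "verts (with_proj (cycle_graph n)) \<noteq> {}" using assms by (simp add: cycle_graph_def)
    fix u v
    assume "u \<in> verts (with_proj (cycle_graph n))" "v \<in> verts (with_proj (cycle_graph n))"
    then have "u < n" "v < n" by (auto simp: cycle_graph_def)
    then show "u \<rightarrow>\<^sup>*\<^bsub>with_proj (cycle_graph n)\<^esub> v"
      by (rule reachable_trans[OF symmetric_reachable[OF sym_arcs reach] reach])
  qed
qed

lemma (in pair_fin_digraph) \<mu>_eq_graph_dist:
  assumes "u \<rightarrow>\<^sup>*\<^bsub>with_proj G\<^esub> v"
  shows "\<mu> (\<lambda>_. 1) u v = ereal (real (graph_dist G u v))"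
proof -
  have cost: "awalk_cost (\<lambda>_. 1) p = real (length p)" for p :: "('a \<times> 'a) list"
    by (induction p) auto
  obtain p where p: "apath u p v" "\<mu> (\<lambda>_. 1) u v = ereal (real (length p))"
    using no_neg_cyc_reach_imp_path[OF assms, of "\<lambda>_. 1"] by (auto simp: cost)
  have "length p \<le> length q" if "apath u q v" for q
    using min_cost_le_walk_cost[OF awalkI_apath[OF that], of "\<lambda>_. 1"] p by (simp add: cost)
  with p show ?thesis
    unfolding graph_dist_def by (auto intro!: Least_equality[symmetric])
qed

lemma (in pair_graph) graph_dist_commute: "graph_dist G u v = graph_dist G v u"
proof -
  have sym: "(b, a) \<in> parcs G" if "(a, b) \<in> parcs G" for a b
    using that pair_sym_arcs by (auto simp: symmetric_def dest: symD)
  have pcas_snoc: "pcas u (p @ [e]) v \<longleftrightarrow> pcas u p (fst e) \<and> snd e = v" for u v :: 'a and p e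
    by (induction p arbitrary: u) auto
  have verts_snoc: "pawalk_verts u (p @ [e]) = butlast (pawalk_verts u p) @ [fst e, snd e]"
    if "pcas u p (fst e)" for u :: 'a and p e
  proof -
    have "pawalk_verts u p \<noteq> []" for u :: 'a and p by (cases p) auto
    with that show ?thesis by (induction p arbitrary: u) auto
  qed
  have rev: "pcas v (rev (map prod.swap p)) u \<and>
      pawalk_verts v (rev (map prod.swap p)) = rev (pawalk_verts u p)" if "pcas u p v" for u v :: 'a and p
    using that
  proof (induction p arbitrary: u)
    case (Cons e p)
    then have IH: "pcas v (rev (map prod.swap p)) (snd e)"
      "pawalk_verts v (rev (map prod.swap p)) = rev (pawalk_verts (snd e) p)" by auto
    have "pawalk_verts (snd e) p = snd e # tl (pawalk_verts (snd e) p)"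
      by (cases p) (use Cons.prems in auto)
    then have "butlast (rev (pawalk_verts (snd e) p)) @ [snd e] = rev (pawalk_verts (snd e) p)"
      "last (rev (pawalk_verts (snd e) p)) = snd e"
      by (metis butlast_snoc rev.simps(2), metis last_snoc rev.simps(2))
    with IH Cons.prems show ?case by (auto simp: pcas_snoc verts_snoc)
  qed auto
  have "apath v (rev (map prod.swap p)) u" if "apath u p v" for u p v
  proof -
    from that have *: "pcas u p v" "set p \<subseteq> parcs G" "u \<in> pverts G" "distinct (pawalk_verts u p)"
      by (auto simp: apath_def awalk_def)
    have "v \<in> pverts G" using that by (auto simp: apath_def dest: awlast_in_verts)
    with * rev[OF *(1)] sym show ?thesis
      by (auto simp: apath_def awalk_def)
  qed
  then have "(\<exists>p. apath u p v \<and> length p = l) \<longleftrightarrow> (\<exists>p. apath v p u \<and> length p = l)" for l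
    by (metis length_map length_rev)
  then show ?thesis unfolding graph_dist_def by simp
qed

end

theory Submission
  imports Defs
begin

text \<open>
  The cycle is cut by its semicircles, the \<open>n\<close> arcs of \<open>n div 2\<close> consecutive vertices: for
  both parities of \<open>n\<close>, exactly \<open>2 * d(u, v)\<close> of them separate \<open>u\<close> from \<open>v\<close>
  (\<open>card_semicircles_separating\<close>). Double counting over a set \<open>A\<close> of \<open>m\<close> vertices, of which
  \<open>a\<^sub>i\<close> lie in the \<open>i\<close>-th semicircle, turns this into
  \<open>2 W(A) = \<Sum>\<^sub>i a\<^sub>i (m - a\<^sub>i)\<close>, that is \<open>8 W(A) = n m\<^sup>2 - \<Sum>\<^sub>i (m - 2 a\<^sub>i)\<^sup>2\<close>.

  The integer \<open>x\<^sub>i = m - 2 a\<^sub>i\<close> has the parity of \<open>m\<close>, and the \<open>x\<^sub>i\<close> sum to \<open>m * (n mod 2)\<close>.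
  Hence \<open>x\<^sub>i\<^sup>2 \<ge> 1\<close> for odd \<open>m\<close> and \<open>x\<^sub>i\<^sup>2 \<ge> 2 x\<^sub>i\<close> for even \<open>m\<close>, which gives an upper bound
  \<open>8 W(A) \<le> wiener_bound n m\<close> depending only on the size of \<open>A\<close> (\<open>wiener_le_bound\<close>). It is
  attained by spreading \<open>m\<close> vertices as evenly as possible around the cycle (\<open>wiener_spread\<close>).

  The bound rewards concentration: replacing two sizes \<open>a\<close>, \<open>b\<close> by \<open>a + b - 1\<close> and \<open>1\<close> never
  lowers the sum of the bounds, and raises it when \<open>a, b \<ge> 2\<close>, with the sole exception
  \<open>a = b = 2\<close> for even \<open>n\<close> (\<open>wiener_bound_merge\<close>). So \<open>wiener_bound n (n - (k - 1))\<close> bounds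
  \<open>8 W\<close> of every surjective coloring. A coloring by the evenly spread set and singletons attains
  it, and then so does every weak maximizer with the same type, that is every one with a class of
  size \<open>n - (k - 1)\<close>. All colorings without such a class stay strictly below, unless \<open>n\<close> is even and
  \<open>n - k \<le> 2\<close>. In that remaining case the only type without such a class is \<open>(1, \<dots>, 1, 2, 2)\<close>, which
  needs \<open>n - k = 2\<close>, and two disjoint antipodal pairs show that it reaches the same value.
\<close>

section \<open>Distances in the cycle\<close>

lemma pverts_cycle_graph [simp]: "pverts (cycle_graph n) = {0..<n}"
  by (simp add: cycle_graph_def)

lemma parcs_cycle_graph_iff:
  assumes "u < n" "v < n"
  shows "(u, v) \<in> parcs (cycle_graph n) \<longleftrightarrow> u \<noteq> v \<and>
    (v = Suc u \<or> u = Suc v \<or> (u = 0 \<and> Suc v = n) \<or> (v = 0 \<and> Suc u = n))"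
proof -
  \<comment> \<open>For \<open>u, v < n\<close> both differences tested for divisibility lie strictly between \<open>- 2 n\<close> and \<open>2 n\<close>.\<close>
  have small: "int n dvd x \<longleftrightarrow> x = 0 \<or> x = int n \<or> x = - int n"
    if "\<bar>x\<bar> < 2 * int n" for x :: int
  proof
    assume "int n dvd x"
    then obtain c where c: "x = int n * c" by (auto elim: dvdE)
    have "\<bar>c\<bar> < 2"
    proof (rule ccontr)
      assume "\<not> \<bar>c\<bar> < 2"
      then have "int n * 2 \<le> int n * \<bar>c\<bar>" by (intro mult_left_mono) auto
      with that c show False by (simp add: abs_mult)
    qed
    then have "c = 0 \<or> c = 1 \<or> c = - 1" by auto
    with c show "x = 0 \<or> x = int n \<or> x = - int n" by auto
  qed auto
  have "\<bar>int u - int v - 1\<bar> < 2 * int n" "\<bar>int u - int v + 1\<bar> < 2 * int n"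
    using assms by auto
  with assms show ?thesis
    by (auto simp: cycle_graph_def cong_iff_dvd_diff small)
qed

text \<open>
  Walks may revisit vertices whereas \<open>graph_dist\<close> minimizes over paths; the shortest-path
  function \<open>\<mu>\<close> with unit weights mediates between the two, because it minimizes over all walks.
\<close>
lemma graph_dist_le_awalk_length:
  assumes "pre_digraph.awalk (with_proj (cycle_graph n)) u p v"
  shows "graph_dist (cycle_graph n) u v \<le> length p"
proof -
  interpret pair_graph "cycle_graph n" by (rule pair_graph_cycle_graph)
  have cost: "awalk_cost (\<lambda>_. 1) q = real (length q)" for q :: "(nat \<times> nat) list"
    by (induction q) auto
  have "\<mu> (\<lambda>_. 1) u v \<le> ereal (awalk_cost (\<lambda>_. 1) p)"
    by (rule min_cost_le_walk_cost[OF assms])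
  moreover have "u \<rightarrow>\<^sup>*\<^bsub>with_proj (cycle_graph n)\<^esub> v"
    using assms by (rule reachable_awalkI)
  ultimately show ?thesis using \<mu>_eq_graph_dist by (simp add: cost)
qed

lemma ex_awalk_around_cycle:
  assumes "u < n"
  shows "\<exists>p. pre_digraph.awalk (with_proj (cycle_graph n)) u p ((u + d) mod n) \<and> length p \<le> d"
proof (induction d)
  interpret pair_graph "cycle_graph n" by (rule pair_graph_cycle_graph)
  case 0
  show ?case using assms by (intro exI[of _ "[]"]) (simp add: awalk_Nil_iff)
next
  interpret pair_graph "cycle_graph n" by (rule pair_graph_cycle_graph)
  case (Suc d)
  then obtain p where p: "awalk u p ((u + d) mod n)" "length p \<le> d" by auto
  show ?case
  proof (cases "n = 1")
    case True
    with p assms show ?thesis by auto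
  next
    case False
    let ?x = "(u + d) mod n" and ?y = "(u + Suc d) mod n"
    have "?x < n" "?y < n" "n > 1" using assms False by auto
    have step: "(x, y) \<in> parcs (cycle_graph n)"
      if "x < n" "y < n" "y = (if Suc x = n then 0 else Suc x)" for x y
      using that \<open>n > 1\<close> by (auto simp: parcs_cycle_graph_iff split: if_splits)
    have "(?x, ?y) \<in> parcs (cycle_graph n)"
      by (rule step[OF \<open>?x < n\<close> \<open>?y < n\<close>]) (simp add: mod_Suc)
    then have "awalk ?x [(?x, ?y)] ?y"
      using \<open>?y < n\<close> by (simp add: awalk_Cons_iff awalk_Nil_iff)
    then have "awalk u (p @ [(?x, ?y)]) ?y" by (rule awalk_appendI[OF p(1)])
    with p(2) show ?thesis by (intro exI[of _ "p @ [(?x, ?y)]"]) simp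
  qed
qed

text \<open>One arc changes the distance around the circle to the target by at most one.\<close>
lemma awalk_length_ge_circular_distance:
  assumes "pre_digraph.awalk (with_proj (cycle_graph n)) u p v" "u < n" "v < n"
  shows "min \<bar>int u - int v\<bar> (int n - \<bar>int u - int v\<bar>) \<le> int (length p)"
  using assms
proof (induction p arbitrary: u)
  interpret pair_graph "cycle_graph n" by (rule pair_graph_cycle_graph)
  case Nil
  then show ?case by (simp add: awalk_Nil_iff)
next
  interpret pair_graph "cycle_graph n" by (rule pair_graph_cycle_graph)
  case (Cons e p)
  obtain w where e: "e = (u, w)" and arc: "(u, w) \<in> parcs (cycle_graph n)" and w: "awalk w p v"
    using Cons.prems(1) by (cases e) (auto simp: awalk_Cons_iff)
  have "w < n" using arc by (auto simp: cycle_graph_def)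
  from Cons.IH[OF w this \<open>v < n\<close>] arc parcs_cycle_graph_iff[OF \<open>u < n\<close> \<open>w < n\<close>]
  show ?case using \<open>u < n\<close> \<open>v < n\<close> \<open>w < n\<close> unfolding e by (auto simp: min_def abs_if split: if_splits)
qed

lemma graph_dist_cycle_graph:
  assumes "u < v" "v < n"
  shows "graph_dist (cycle_graph n) u v = min (v - u) (n - (v - u))"
proof (rule antisym)
  interpret pair_graph "cycle_graph n" by (rule pair_graph_cycle_graph)
  let ?d = "graph_dist (cycle_graph n) u v"
  obtain p where p: "awalk u p ((u + (v - u)) mod n)" "length p \<le> v - u"
    using ex_awalk_around_cycle[of u n "v - u"] assms by auto
  obtain q where q: "awalk v q ((v + (n - (v - u))) mod n)" "length q \<le> n - (v - u)"
    using ex_awalk_around_cycle[of v n "n - (v - u)"] assms by auto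
  have "(u + (v - u)) mod n = v" using assms by simp
  with p have "awalk u p v" by simp
  then have 1: "?d \<le> v - u" using p(2) graph_dist_le_awalk_length by (meson le_trans)
  have "(v + (n - (v - u))) mod n = (u + n) mod n" using assms by simp
  then have "(v + (n - (v - u))) mod n = u" using assms by simp
  with q have "awalk v q u" by simp
  then have "graph_dist (cycle_graph n) v u \<le> n - (v - u)"
    using q(2) graph_dist_le_awalk_length by (meson le_trans)
  then have 2: "?d \<le> n - (v - u)" by (simp add: graph_dist_commute)
  from 1 2 show "?d \<le> min (v - u) (n - (v - u))" by simp
  have "\<exists>l r. apath u r v \<and> length r = l"
    using apath_awalk_to_apath[OF \<open>awalk u p v\<close>] by blast
  then have "\<exists>r. apath u r v \<and> length r = ?d"
    unfolding graph_dist_def by (rule LeastI_ex)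
  then obtain r where "awalk u r v" "length r = ?d" by (auto dest: awalkI_apath)
  from awalk_length_ge_circular_distance[OF this(1)] this(2) assms
  show "min (v - u) (n - (v - u)) \<le> ?d" by (simp add: min_def split: if_splits) linarith+
qed

section \<open>Counting separating semicircles\<close>

text \<open>
  The \<open>n div 2\<close> consecutive vertices starting at \<open>i\<close>, for \<open>i < n\<close>; the second interval is the part
  that wraps around past \<open>0\<close>.
\<close>
definition semicircle :: "nat \<Rightarrow> nat \<Rightarrow> nat set" where
  "semicircle n i = {i..<min n (i + n div 2)} \<union> {0..<i + n div 2 - n}"

lemma mem_semicircle_iff:
  assumes "v < n"
  shows "v \<in> semicircle n i \<longleftrightarrow> (i \<le> v \<and> v < i + n div 2) \<or> v + n < i + n div 2"
  using assms by (auto simp: semicircle_def)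

lemma card_semicircles_containing:
  assumes "v < n"
  shows "card {i \<in> {0..<n}. v \<in> semicircle n i} = n div 2"
proof -
  let ?p = "n div 2"
  have "{i \<in> {0..<n}. v \<in> semicircle n i} = {v + 1 - ?p..<v + 1} \<union> {v + n + 1 - ?p..<n}"
    using assms by (auto simp: mem_semicircle_iff)
  also have "card \<dots> = (v + 1 - (v + 1 - ?p)) + (n - (v + n + 1 - ?p))"
    by (subst card_Un_disjoint) auto
  finally show ?thesis using assms by linarith
qed

text \<open>
  For \<open>n \<ge> 3\<close>, a semicircle separates \<open>u\<close> from \<open>v\<close> iff exactly one of its two boundary edges lies
  on a given shortest path between them. That path is too short to contain both, so each of the two
  boundary edges accounts for \<open>d(u, v)\<close> positions of the semicircle.
\<close>
lemma card_semicircles_separating: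
  assumes "u < v" "v < n"
  shows "card {i \<in> {0..<n}. (u \<in> semicircle n i) \<noteq> (v \<in> semicircle n i)} =
    2 * graph_dist (cycle_graph n) u v"
proof -
  define p where "p = n div 2"
  have p: "n = 2 * p \<or> n = 2 * p + 1" unfolding p_def by linarith
  \<comment> \<open>\<open>?I\<close> and \<open>?J\<close> collect the semicircles with \<open>u\<close> but not \<open>v\<close>, without and with wrap-around;
    \<open>?K\<close> those with \<open>v\<close> but not \<open>u\<close>. These form one interval, as a wrap-around that reaches \<open>v\<close>
    also reaches \<open>u\<close>.\<close>
  let ?I = "{u + 1 - p..<min (u + 1) (v + 1 - p)}"
  let ?J = "{max (v + 1) (u + n + 1 - p)..<min n (v + n + 1 - p)}"
  let ?K = "{max (u + 1) (v + 1 - p)..<min (v + 1) (u + n + 1 - p)}"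
  have un: "{i \<in> {0..<n}. (u \<in> semicircle n i) \<noteq> (v \<in> semicircle n i)} = ?I \<union> ?J \<union> ?K"
    using assms p by (auto simp: mem_semicircle_iff p_def[symmetric])
  have "?I \<inter> ?J = {}" "(?I \<union> ?J) \<inter> ?K = {}" by auto
  then have card: "card (?I \<union> ?J \<union> ?K) = card ?I + card ?J + card ?K"
    by (simp only: card_Un_disjoint finite_Un finite_atLeastLessThan simp_thms)
  have "card ?I + card ?J + card ?K = 2 * min (v - u) (n - (v - u))"
    using p
  proof
    assume "n = 2 * p"
    with assms show ?thesis by (auto split: split_min split_max)
  next
    assume "n = 2 * p + 1"
    with assms show ?thesis by (auto split: split_min split_max)
  qed
  then show ?thesis
    using assms by (simp only: un card graph_dist_cycle_graph)
qed

lemma card_pairs_separated: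
  assumes "finite A"
  shows "card {e. e \<subseteq> A \<and> card e = 2 \<and> card (e \<inter> S) = 1} = card (A \<inter> S) * (card A - card (A \<inter> S))"
proof -
  let ?E = "{e. e \<subseteq> A \<and> card e = 2 \<and> card (e \<inter> S) = 1}"
  have "bij_betw (\<lambda>(x, y). {x, y}) ((A \<inter> S) \<times> (A - S)) ?E"
  proof (rule bij_betwI')
    fix z z' assume "z \<in> (A \<inter> S) \<times> (A - S)" "z' \<in> (A \<inter> S) \<times> (A - S)"
    then show "((case z of (x, y) \<Rightarrow> {x, y}) = (case z' of (x, y) \<Rightarrow> {x, y})) = (z = z')"
      by (auto simp: doubleton_eq_iff)
  next
    fix z assume "z \<in> (A \<inter> S) \<times> (A - S)"
    then obtain x y where z: "z = (x, y)" "x \<in> A" "x \<in> S" "y \<in> A" "y \<notin> S" by auto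
    then have "{x, y} \<inter> S = {x}" "x \<noteq> y" by auto
    with z show "(case z of (x, y) \<Rightarrow> {x, y}) \<in> ?E" by auto
  next
    fix e assume "e \<in> ?E"
    then have e: "e \<subseteq> A" "card e = 2" "card (e \<inter> S) = 1" by auto
    then obtain x where x: "e \<inter> S = {x}" by (auto simp: card_1_singleton_iff)
    have "x \<in> e" using x by auto
    then obtain y where "e = {x, y}" "x \<noteq> y" using e(2) by (auto simp: card_2_iff)
    with x e(1) show "\<exists>z\<in>(A \<inter> S) \<times> (A - S). e = (case z of (x, y) \<Rightarrow> {x, y})"
      by (intro bexI[of _ "(x, y)"]) auto
  qed
  then have "card ?E = card ((A \<inter> S) \<times> (A - S))" by (simp add: bij_betw_same_card)
  also have "\<dots> = card (A \<inter> S) * (card A - card (A \<inter> S))"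
    using assms by (simp add: card_cartesian_product card_Diff_subset_Int)
  finally show ?thesis .
qed

text \<open>Double counting of the pairs of a vertex pair in \<open>A\<close> and a semicircle separating it.\<close>
lemma two_wiener_cycle_graph:
  assumes "A \<subseteq> {0..<n}"
  shows "2 * wiener (cycle_graph n) A =
    (\<Sum>i<n. card (A \<inter> semicircle n i) * (card A - card (A \<inter> semicircle n i)))"
proof -
  interpret pair_graph "cycle_graph n" by (rule pair_graph_cycle_graph)
  have fin: "finite A" using assms finite_subset by blast
  let ?E = "{e. e \<subseteq> A \<and> card e = 2}"
  let ?d = "\<lambda>e. THE d. \<forall>u v. e = {u, v} \<longrightarrow> d = graph_dist (cycle_graph n) u v"
  have finE: "finite ?E" using fin by simp
  have pair: "2 * ?d e = (\<Sum>i<n. of_bool (card (e \<inter> semicircle n i) = 1))" if "e \<in> ?E" for e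
  proof -
    from that obtain x y where "e = {x, y}" "x \<noteq> y" by (auto simp: card_2_iff)
    then obtain u v where e: "e = {u, v}" and "u < v"
      by (metis insert_commute linorder_neqE_nat)
    have "v < n" using that assms e by auto
    have d: "?d e = graph_dist (cycle_graph n) u v"
      unfolding e by (rule the_equality) (auto simp: doubleton_eq_iff graph_dist_commute)
    have sep: "card (e \<inter> S) = 1 \<longleftrightarrow> (u \<in> S) \<noteq> (v \<in> S)" for S
      unfolding e using \<open>u < v\<close> by (auto simp: Int_insert_left)
    have "2 * ?d e = card {i \<in> {0..<n}. (u \<in> semicircle n i) \<noteq> (v \<in> semicircle n i)}"
      unfolding d using card_semicircles_separating[OF \<open>u < v\<close> \<open>v < n\<close>] by simp
    also have "\<dots> = (\<Sum>i<n. of_bool (card (e \<inter> semicircle n i) = 1))"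
      unfolding sep by (simp add: sum.If_cases of_bool_def Int_def lessThan_atLeast0)
    finally show ?thesis .
  qed
  have "2 * wiener (cycle_graph n) A = (\<Sum>e\<in>?E. 2 * ?d e)"
    unfolding wiener_def by (simp add: sum_distrib_left)
  also have "\<dots> = (\<Sum>e\<in>?E. \<Sum>i<n. of_bool (card (e \<inter> semicircle n i) = 1))"
    using pair by (rule sum.cong[OF refl])
  also have "\<dots> = (\<Sum>i<n. \<Sum>e\<in>?E. of_bool (card (e \<inter> semicircle n i) = 1))"
    by (rule sum.swap)
  also have "\<dots> = (\<Sum>i<n. card {e. e \<subseteq> A \<and> card e = 2 \<and> card (e \<inter> semicircle n i) = 1})"
    using finE by (intro sum.cong refl) (simp add: sum.If_cases of_bool_def Int_def conj_assoc)
  finally show ?thesis by (simp only: card_pairs_separated[OF fin])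
qed

lemma sum_card_Int_semicircle:
  assumes "A \<subseteq> {0..<n}"
  shows "(\<Sum>i<n. card (A \<inter> semicircle n i)) = card A * (n div 2)"
proof -
  have fin: "finite A" using assms finite_subset by blast
  have "(\<Sum>i<n. card (A \<inter> semicircle n i)) = (\<Sum>i<n. \<Sum>v\<in>A. of_bool (v \<in> semicircle n i))"
    using fin by (simp add: sum.If_cases of_bool_def Int_def)
  also have "\<dots> = (\<Sum>v\<in>A. \<Sum>i<n. of_bool (v \<in> semicircle n i))" by (rule sum.swap)
  also have "\<dots> = (\<Sum>v\<in>A. n div 2)"
  proof (rule sum.cong[OF refl])
    fix v assume "v \<in> A"
    with assms card_semicircles_containing[of v n]
    show "(\<Sum>i<n. of_bool (v \<in> semicircle n i)) = n div 2"
      by (auto simp: sum.If_cases of_bool_def Int_def lessThan_atLeast0)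
  qed
  finally show ?thesis by simp
qed

section \<open>The largest Wiener index of a vertex set of given size\<close>

text \<open>
  For \<open>m \<le> n\<close> this is eight times the largest Wiener index of \<open>m\<close> vertices of the cycle. The factor
  eight clears the denominators of both parity cases.
\<close>
definition wiener_bound :: "nat \<Rightarrow> nat \<Rightarrow> int" where
  "wiener_bound n m =
    (if odd m then int n * ((int m)\<^sup>2 - 1) else int n * (int m)\<^sup>2 - 2 * int m * int (n mod 2))"

text \<open>
  The loss against \<open>wiener_bound\<close> caused by one semicircle, where \<open>x\<close> is the number of vertices of the
  \<open>m\<close>-set outside it minus the number inside. In the even case the linear term is there because the
  values \<open>x\<close> have the prescribed sum \<open>m * (n mod 2)\<close>: for odd \<open>n\<close>, semicircles are slightly shorter
  than their complements.
\<close>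
definition deficit :: "nat \<Rightarrow> int \<Rightarrow> int" where
  "deficit m x = (if odd m then x\<^sup>2 - 1 else x\<^sup>2 - 2 * x)"

text \<open>
  The imbalance has the parity of \<open>m\<close>: an odd integer has square at least one, and
  \<open>x\<^sup>2 - 2 x = x (x - 2)\<close> is negative for no even integer.
\<close>
lemma deficit_nonneg: "0 \<le> deficit m (int m - 2 * int a)"
proof (cases "odd m")
  case True
  then have "int m - 2 * int a \<noteq> 0" by presburger
  then have "0 < (int m - 2 * int a)\<^sup>2" by simp
  with True show ?thesis unfolding deficit_def by simp
next
  case False
  then obtain l where "m = 2 * l" by auto
  define y where "y = int l - int a"
  have "deficit m (int m - 2 * int a) = 4 * (y * (y - 1))"
    using False \<open>m = 2 * l\<close> by (simp add: deficit_def y_def power2_eq_square algebra_simps)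
  moreover have "0 \<le> y * (y - 1)" by (cases "y \<le> 0") (auto simp: zero_le_mult_iff)
  ultimately show ?thesis by simp
qed

lemma wiener_bound_diff:
  assumes "A \<subseteq> {0..<n}"
  shows "wiener_bound n (card A) - 8 * int (wiener (cycle_graph n) A) =
    (\<Sum>i<n. deficit (card A) (int (card A) - 2 * int (card (A \<inter> semicircle n i))))"
proof -
  have fin: "finite A" using assms finite_subset by blast
  define m where "m = int (card A)"
  define a where "a i = int (card (A \<inter> semicircle n i))" for i
  have le: "card (A \<inter> semicircle n i) \<le> card A" for i
    using fin by (intro card_mono) auto
  have "2 * int (wiener (cycle_graph n) A) = int (2 * wiener (cycle_graph n) A)" by simp
  also have "\<dots> = (\<Sum>i<n. a i * (m - a i))"
    unfolding two_wiener_cycle_graph[OF assms] of_nat_sum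
    by (intro sum.cong refl) (simp add: a_def m_def of_nat_diff le)
  finally have "8 * int (wiener (cycle_graph n) A) = 4 * (\<Sum>i<n. a i * (m - a i))" by simp
  also have "\<dots> = (\<Sum>i<n. m\<^sup>2 - (m - 2 * a i)\<^sup>2)"
    unfolding sum_distrib_left by (intro sum.cong refl) (simp add: power2_eq_square algebra_simps)
  also have "\<dots> = int n * m\<^sup>2 - (\<Sum>i<n. (m - 2 * a i)\<^sup>2)"
    by (simp add: sum_subtractf)
  finally have W: "8 * int (wiener (cycle_graph n) A) = int n * m\<^sup>2 - (\<Sum>i<n. (m - 2 * a i)\<^sup>2)" .
  have "(\<Sum>i<n. a i) = int (\<Sum>i<n. card (A \<inter> semicircle n i))" by (simp add: a_def)
  then have "(\<Sum>i<n. a i) = m * int (n div 2)"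
    unfolding sum_card_Int_semicircle[OF assms] by (simp add: m_def)
  then have "(\<Sum>i<n. m - 2 * a i) = m * (int n - 2 * int (n div 2))"
    by (simp add: sum_subtractf right_diff_distrib flip: sum_distrib_left)
  moreover have "int n - 2 * int (n div 2) = int (n mod 2)" by presburger
  ultimately have avg: "(\<Sum>i<n. m - 2 * a i) = m * int (n mod 2)" by simp
  show ?thesis
  proof (cases "odd (card A)")
    case True
    then show ?thesis using W
      by (simp add: wiener_bound_def deficit_def m_def[symmetric] a_def[symmetric] sum_subtractf algebra_simps)
  next
    case False
    then show ?thesis using W avg
      by (simp add: wiener_bound_def deficit_def m_def[symmetric] a_def[symmetric] sum_subtractf
          sum_distrib_left[symmetric])
  qed
qed

lemma wiener_le_bound:
  assumes "A \<subseteq> {0..<n}"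
  shows "8 * int (wiener (cycle_graph n) A) \<le> wiener_bound n (card A)"
proof -
  have "0 \<le> wiener_bound n (card A) - 8 * int (wiener (cycle_graph n) A)"
    unfolding wiener_bound_diff[OF assms] by (intro sum_nonneg deficit_nonneg)
  then show ?thesis by simp
qed

text \<open>
  The vertices at which \<open>v * m div n\<close> jumps, which are distributed as evenly as possible. The jumps
  have height one for \<open>m \<le> n\<close>, so that the vertices in an interval can be counted by telescoping.
\<close>
definition spread :: "nat \<Rightarrow> nat \<Rightarrow> nat set" where
  "spread n m = {v \<in> {0..<n}. v * m div n < (v + 1) * m div n}"

lemma card_spread_Int_interval:
  assumes "a \<le> b" "b \<le> n" "m \<le> n"
  shows "card (spread n m \<inter> {a..<b}) = b * m div n - a * m div n"
  using assms(1,2)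
proof (induction b rule: dec_induct)
  case base
  then show ?case by simp
next
  case (step b)
  have "n > 0" using step by simp
  have mono: "a * m div n \<le> b * m div n" using step by (intro div_le_mono mult_le_mono) auto
  have "b * m div n \<le> (b + 1) * m div n" by (intro div_le_mono mult_le_mono) auto
  moreover have "(b + 1) * m div n \<le> (b * m + n) div n"
    using assms(3) by (intro div_le_mono) simp
  ultimately have jump: "(b + 1) * m div n = b * m div n + of_bool (b \<in> spread n m)"
    using \<open>n > 0\<close> step by (auto simp: spread_def)
  have "spread n m \<inter> {a..<Suc b} =
      (if b \<in> spread n m then insert b (spread n m \<inter> {a..<b}) else spread n m \<inter> {a..<b})"
    using step by (auto simp: less_Suc_eq)
  then have "card (spread n m \<inter> {a..<Suc b}) = card (spread n m \<inter> {a..<b}) + of_bool (b \<in> spread n m)"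
    by simp
  with step mono jump show ?case by simp
qed

lemma card_spread: "m \<le> n \<Longrightarrow> card (spread n m) = m"
  using card_spread_Int_interval[of 0 n n m]
  by (cases "n = 0") (auto simp: spread_def Int_def cong: conj_cong)

text \<open>
  The telescoped count also holds across \<open>0\<close>, as \<open>v * m div n\<close> grows by exactly \<open>m\<close> when \<open>v\<close> grows
  by \<open>n\<close>.
\<close>
lemma card_spread_Int_semicircle:
  assumes "i < n" "m \<le> n"
  shows "card (spread n m \<inter> semicircle n i) = (i + n div 2) * m div n - i * m div n"
proof (cases "i + n div 2 \<le> n")
  case True
  with assms card_spread_Int_interval[of i "i + n div 2" n m] show ?thesis
    by (simp add: semicircle_def min_absorb2)
next
  case False
  define j where "j = i + n div 2 - n"
  have j: "i + n div 2 = n + j" "j \<le> i" using False by (auto simp: j_def)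
  have "spread n m \<inter> semicircle n i = (spread n m \<inter> {i..<n}) \<union> (spread n m \<inter> {0..<j})"
    using False by (auto simp: semicircle_def j_def)
  moreover have "card \<dots> = card (spread n m \<inter> {i..<n}) + card (spread n m \<inter> {0..<j})"
    using j by (intro card_Un_disjoint) auto
  moreover have "card (spread n m \<inter> {i..<n}) = m - i * m div n"
    using assms card_spread_Int_interval[of i n n m] by simp
  moreover have "card (spread n m \<inter> {0..<j}) = j * m div n"
    using assms j card_spread_Int_interval[of 0 j n m] by simp
  moreover have "(i + n div 2) * m div n = m + j * m div n"
    unfolding j using assms by (simp add: add_mult_distrib)
  moreover have "i * m div n \<le> m"
    using assms div_le_mono[of "i * m" "n * m" n] by simp
  ultimately show ?thesis by simp
qed

text \<open>
  A semicircle meets the spread set in less than one vertex more or fewer than the average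
  \<open>(n div 2) * m / n\<close>. This confines the imbalance to \<open>- 1, 0, 1, 2\<close>, and there the deficit of the
  correct parity vanishes.
\<close>
lemma wiener_spread:
  assumes "m \<le> n"
  shows "8 * int (wiener (cycle_graph n) (spread n m)) = wiener_bound n m"
proof -
  have "deficit m (int m - 2 * int (card (spread n m \<inter> semicircle n i))) = 0" if "i < n" for i
  proof (cases "m = 0")
    case True
    then show ?thesis by (simp add: deficit_def spread_def)
  next
    case False
    define p r where "p = n div 2" and "r = n mod 2"
    have n: "int n = 2 * int p + int r" unfolding p_def r_def by presburger
    define s t where "s = i * m div n" and "t = (i + p) * m div n"
    have "s \<le> t" unfolding s_def t_def by (intro div_le_mono mult_le_mono) auto
    then have a: "int (card (spread n m \<inter> semicircle n i)) = int t - int s"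
      using card_spread_Int_semicircle[OF \<open>i < n\<close> assms] by (simp add: s_def t_def p_def)
    define x where "x = int m - 2 * (int t - int s)"
    \<comment> \<open>All divisions are replaced by their defining inequalities, so that \<open>n * x\<close> can be enclosed
      linearly in the products of the other variables.\<close>
    have s: "n * s \<le> i * m" "i * m < n * s + n"
      using \<open>i < n\<close> mult_div_mod_eq[of n "i * m"] mod_less_divisor[of n "i * m"]
      unfolding s_def by linarith+
    have t: "n * t \<le> (i + p) * m" "(i + p) * m < n * t + n"
      using \<open>i < n\<close> mult_div_mod_eq[of n "(i + p) * m"] mod_less_divisor[of n "(i + p) * m"]
      unfolding t_def by linarith+
    have s': "int n * int s \<le> int i * int m" "int i * int m < int n * int s + int n"
      using s by (simp_all flip: of_nat_mult of_nat_add)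
    have t': "int n * int t \<le> int i * int m + int p * int m"
        "int i * int m + int p * int m < int n * int t + int n"
      using t by (simp_all add: add_mult_distrib flip: of_nat_mult of_nat_add)
    have "int n * x = int n * int m - 2 * (int n * int t) + 2 * (int n * int s)"
      by (simp add: x_def algebra_simps)
    moreover have "int n * int m = 2 * (int p * int m) + int r * int m"
      by (simp add: n algebra_simps)
    ultimately have "int r * int m - 2 * int n < int n * x" "int n * x < int r * int m + 2 * int n"
      using s' t' by linarith+
    moreover have "r = 0 \<or> r = 1" unfolding r_def by auto
    then have "0 \<le> int r * int m" "int r * int m \<le> int n" using assms by auto
    ultimately have "int n * (- 2) < int n * x" "int n * x < int n * 3" by linarith+
    then have x: "- 2 < x" "x < 3"
      using mult_less_cancel_left_pos[of "int n" "- 2" x] mult_less_cancel_left_pos[of "int n" x 3]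
        \<open>i < n\<close> by simp_all
    have par: "even x \<longleftrightarrow> even m" unfolding x_def by simp
    have "deficit m x = 0"
    proof (cases "odd m")
      case True
      with x par have "x = 1 \<or> x = - 1" by presburger
      with True show ?thesis by (auto simp: deficit_def)
    next
      case False
      with x par have "x = 0 \<or> x = 2" by presburger
      with False show ?thesis by (auto simp: deficit_def)
    qed
    then show ?thesis by (simp add: a x_def)
  qed
  moreover have "spread n m \<subseteq> {0..<n}" by (auto simp: spread_def)
  ultimately show ?thesis using wiener_bound_diff[of "spread n m" n] by (simp add: card_spread assms)
qed

lemma wiener_bound_1 [simp]: "wiener_bound n (Suc 0) = 0"
  by (simp add: wiener_bound_def)

section \<open>Concentration increases the bound\<close>

text \<open>
  With \<open>a = c + 1\<close> and \<open>b = d + 1\<close> the gain is \<open>2 n c d\<close> up to corrections depending on parities.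
  The delicate case is that of even \<open>a\<close> and \<open>b\<close>, where the gain is \<open>2 n (c d - 1)\<close>, plus a
  positive term for odd \<open>n\<close>. It vanishes only for \<open>c = d = 1\<close> and even \<open>n\<close>.
\<close>
lemma wiener_bound_merge:
  assumes "1 \<le> a" "1 \<le> b" "2 \<le> n"
  shows "wiener_bound n a + wiener_bound n b \<le> wiener_bound n (a + b - 1)"
    and "2 \<le> a \<Longrightarrow> 2 \<le> b \<Longrightarrow> odd n \<or> 4 < a + b \<Longrightarrow>
      wiener_bound n a + wiener_bound n b < wiener_bound n (a + b - 1)"
proof -
  obtain c d where c: "a = Suc c" and d: "b = Suc d"
    using assms by (metis Suc_le_D One_nat_def)
  define r where "r = n mod 2"
  have r: "r = 0 \<or> r = 1" "odd n \<Longrightarrow> r = 1" by (auto simp: r_def odd_iff_mod_2_eq_one)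
  have n: "int n > int r" using r(1) assms(3) by auto
  have sum: "a + b - 1 = Suc (c + d)" by (simp add: c d)
  let ?D = "wiener_bound n (a + b - 1) - (wiener_bound n a + wiener_bound n b)"
  have D: "?D = (if even c then
      if even d then 2 * int n * int c * int d else 2 * int c * (int n * int d - int r)
    else if even d then 2 * int d * (int n * int c - int r)
      else 2 * int n * (int c * int d - 1) + 2 * int r * (int c + int d + 2))"
    unfolding sum c d wiener_bound_def r_def[symmetric]
    by (simp add: power2_eq_square algebra_simps)
  have odd_pos: "int n * int z - int r > 0" if "odd z" for z
  proof -
    have "int n * 1 \<le> int n * int z" using that by (intro mult_left_mono) (auto elim: oddE)
    with n show ?thesis by linarith
  qed
  have "?D \<ge> 0 \<and> (2 \<le> a \<and> 2 \<le> b \<and> (odd n \<or> 4 < a + b) \<longrightarrow> ?D > 0)"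
  proof (cases "odd c \<and> odd d")
    case True
    then have cd: "c \<ge> 1" "d \<ge> 1" by (auto elim: oddE)
    then have "1 * 1 \<le> c * d" by (intro mult_le_mono) auto
    then have 1: "1 \<le> int c * int d" by (simp flip: of_nat_mult)
    have "int c * int d > 1" if "4 < a + b"
    proof -
      have "(int c - 1) * (int d - 1) \<ge> 0" using cd by simp
      with that show ?thesis by (simp add: c d algebra_simps)
    qed
    then have 2: "0 < 2 * int n * (int c * int d - 1)" if "4 < a + b"
      using that assms(3) by simp
    have 3: "0 \<le> 2 * int n * (int c * int d - 1)" using 1 by simp
    have "?D = 2 * int n * (int c * int d - 1) + 2 * int r * (int c + int d + 2)"
      using True by (simp only: D if_False simp_thms)
    with 2 3 r show ?thesis by (auto intro: add_nonneg_pos)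
  next
    case False
    then show ?thesis unfolding D using odd_pos assms(3)
      by (auto simp: c d less_imp_le)
  qed
  then show "wiener_bound n a + wiener_bound n b \<le> wiener_bound n (a + b - 1)"
    and "2 \<le> a \<Longrightarrow> 2 \<le> b \<Longrightarrow> odd n \<or> 4 < a + b \<Longrightarrow>
      wiener_bound n a + wiener_bound n b < wiener_bound n (a + b - 1)"
    by auto
qed

text \<open>Iterated merging moves everything above one vertex per class into a single class.\<close>
lemma sum_wiener_bound_le:
  assumes "finite I" "\<And>i. i \<in> I \<Longrightarrow> 1 \<le> c i" "2 \<le> n"
  shows "(\<Sum>i\<in>I. wiener_bound n (c i)) \<le> wiener_bound n (1 + (\<Sum>i\<in>I. c i - 1))"
  using assms(1,2)
proof (induction I rule: finite_induct)
  case empty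
  then show ?case by simp
next
  case (insert i I)
  have "(\<Sum>j\<in>insert i I. wiener_bound n (c j)) \<le> wiener_bound n (c i) + wiener_bound n (1 + (\<Sum>j\<in>I. c j - 1))"
    using insert by simp
  also have "\<dots> \<le> wiener_bound n (c i + (1 + (\<Sum>j\<in>I. c j - 1)) - 1)"
    using insert.prems assms(3) by (intro wiener_bound_merge) auto
  also have "c i + (1 + (\<Sum>j\<in>I. c j - 1)) - 1 = 1 + (\<Sum>j\<in>insert i I. c j - 1)"
    using insert by (simp add: Suc_le_eq)
  finally show ?case .
qed

section \<open>Colorings of the cycle\<close>

lemma finite_color_class [simp]: "finite (color_class (cycle_graph n) f i)"
  by (simp add: color_class_def)

lemma color_class_subset: "color_class (cycle_graph n) f i \<subseteq> {0..<n}"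
  by (auto simp: color_class_def)

lemma card_color_class_ge_1:
  assumes "f \<in> surj_colorings k (cycle_graph n)" "i \<in> {1..k}"
  shows "1 \<le> card (color_class (cycle_graph n) f i)"
proof -
  have "i \<in> f ` {0..<n}" using assms by (simp add: surj_colorings_def)
  then have "color_class (cycle_graph n) f i \<noteq> {}" by (auto simp: color_class_def)
  then show ?thesis by (simp add: Suc_le_eq card_gt_0_iff)
qed

lemma sum_card_color_class:
  assumes "f \<in> surj_colorings k (cycle_graph n)"
  shows "(\<Sum>i\<in>{1..k}. card (color_class (cycle_graph n) f i)) = n"
proof -
  have "{0..<n} = (\<Union>i\<in>{1..k}. color_class (cycle_graph n) f i)"
    using assms by (auto simp: surj_colorings_def color_class_def)
  then have "n = card (\<Union>i\<in>{1..k}. color_class (cycle_graph n) f i)" by (metis card_atLeastLessThan diff_zero)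
  also have "\<dots> = (\<Sum>i\<in>{1..k}. card (color_class (cycle_graph n) f i))"
    by (rule card_UN_disjoint) (auto simp: color_class_def)
  finally show ?thesis by simp
qed

lemma card_color_class_complement:
  assumes f: "f \<in> surj_colorings k (cycle_graph n)" and i: "i \<in> {1..k}"
  shows "card (color_class (cycle_graph n) f i) \<le> n - (k - 1)"
    and "(\<Sum>j\<in>{1..k} - {i}. card (color_class (cycle_graph n) f j) - 1) + (k - 1) =
      n - card (color_class (cycle_graph n) f i)"
proof -
  let ?c = "\<lambda>j. card (color_class (cycle_graph n) f j)"
  have ge: "1 \<le> ?c j" if "j \<in> {1..k}" for j
    by (rule card_color_class_ge_1[OF f that])
  have "n = ?c i + (\<Sum>j\<in>{1..k} - {i}. ?c j)"
    using sum_card_color_class[OF f] i by (simp add: sum.remove)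
  also have "(\<Sum>j\<in>{1..k} - {i}. ?c j) = (\<Sum>j\<in>{1..k} - {i}. (?c j - 1) + 1)"
    using ge by (intro sum.cong refl) force
  also have "\<dots> = (\<Sum>j\<in>{1..k} - {i}. ?c j - 1) + (k - 1)"
    using i by (simp only: sum.distrib) simp
  finally have n: "n = ?c i + ((\<Sum>j\<in>{1..k} - {i}. ?c j - 1) + (k - 1))" .
  from n show "?c i \<le> n - (k - 1)" by linarith
  from n show "(\<Sum>j\<in>{1..k} - {i}. ?c j - 1) + (k - 1) = n - ?c i" by linarith
qed

lemma ex_card_color_class_ge_2:
  assumes "f \<in> surj_colorings k (cycle_graph n)" "k < n"
  shows "\<exists>i\<in>{1..k}. 2 \<le> card (color_class (cycle_graph n) f i)"
proof (rule ccontr)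
  assume "\<not> ?thesis"
  then have "\<forall>i\<in>{1..k}. card (color_class (cycle_graph n) f i) < 2" by (meson not_le)
  then have "(\<Sum>i\<in>{1..k}. card (color_class (cycle_graph n) f i)) \<le> (\<Sum>i\<in>{1..k}. 1)"
    by (intro sum_mono) fastforce
  with sum_card_color_class[OF assms(1)] assms(2) show False by simp
qed

lemma eight_coloring_wiener_le:
  "8 * int (coloring_wiener k (cycle_graph n) f) \<le>
    (\<Sum>i\<in>{1..k}. wiener_bound n (card (color_class (cycle_graph n) f i)))"
  unfolding coloring_wiener_def of_nat_sum sum_distrib_left
  by (intro sum_mono wiener_le_bound color_class_subset)

text \<open>
  Merging all classes but \<open>i\<close> into one of size \<open>r i\<close> leaves two sizes, whose final merge can be
  examined for strictness. For the strict bound, \<open>i\<close> is chosen with at least two vertices; not being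
  the largest possible class, it leaves \<open>r i \<ge> 2\<close>.
\<close>
lemma coloring_wiener_le_concentrated:
  assumes f: "f \<in> surj_colorings k (cycle_graph n)" and "2 \<le> k" "k \<le> n"
  shows "8 * int (coloring_wiener k (cycle_graph n) f) \<le> wiener_bound n (n - (k - 1))"
    and "\<forall>i\<in>{1..k}. card (color_class (cycle_graph n) f i) \<noteq> n - (k - 1) \<Longrightarrow> odd n \<or> 2 < n - k \<Longrightarrow>
      8 * int (coloring_wiener k (cycle_graph n) f) < wiener_bound n (n - (k - 1))"
proof -
  let ?c = "\<lambda>j. card (color_class (cycle_graph n) f j)"
  let ?W = "8 * int (coloring_wiener k (cycle_graph n) f)"
  have ge: "1 \<le> ?c j" if "j \<in> {1..k}" for j
    by (rule card_color_class_ge_1[OF f that])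
  define r where "r i = 1 + (\<Sum>j\<in>{1..k} - {i}. ?c j - 1)" for i
  have r: "?c i + r i - 1 = n - (k - 1)" if "i \<in> {1..k}" for i
    using card_color_class_complement[OF f that] assms(2,3) unfolding r_def by linarith
  have split: "?W \<le> wiener_bound n (?c i) + wiener_bound n (r i)" if i: "i \<in> {1..k}" for i
  proof -
    have "?W \<le> (\<Sum>i\<in>{1..k}. wiener_bound n (?c i))" by (rule eight_coloring_wiener_le)
    also have "\<dots> = wiener_bound n (?c i) + (\<Sum>j\<in>{1..k} - {i}. wiener_bound n (?c j))"
      using i by (simp add: sum.remove)
    also have "(\<Sum>j\<in>{1..k} - {i}. wiener_bound n (?c j)) \<le> wiener_bound n (r i)"
      unfolding r_def using ge assms(2,3) by (intro sum_wiener_bound_le) auto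
    finally show ?thesis by simp
  qed
  have "1 \<in> {1..k}" using assms(2) by simp
  have "wiener_bound n (?c 1) + wiener_bound n (r 1) \<le> wiener_bound n (?c 1 + r 1 - 1)"
    using ge[OF \<open>1 \<in> {1..k}\<close>] assms(2,3) by (intro wiener_bound_merge) (auto simp: r_def)
  with split[OF \<open>1 \<in> {1..k}\<close>] r[OF \<open>1 \<in> {1..k}\<close>] show "?W \<le> wiener_bound n (n - (k - 1))" by simp
  assume small: "\<forall>i\<in>{1..k}. ?c i \<noteq> n - (k - 1)" and n: "odd n \<or> 2 < n - k"
  have "k \<noteq> n"
    using small card_color_class_complement(1)[OF f \<open>1 \<in> {1..k}\<close>] ge[OF \<open>1 \<in> {1..k}\<close>] \<open>1 \<in> {1..k}\<close>
    by force
  then have "\<exists>i\<in>{1..k}. 2 \<le> ?c i"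
    using ex_card_color_class_ge_2[OF f] assms(3) by simp
  then obtain i where i: "i \<in> {1..k}" "2 \<le> ?c i" by blast
  have "?c i < n - (k - 1)" using card_color_class_complement(1)[OF f i(1)] small i(1) by force
  with r[OF i(1)] have "2 \<le> r i" by linarith
  moreover have "odd n \<or> 4 < ?c i + r i" using n r[OF i(1)] assms(2) by linarith
  ultimately have "wiener_bound n (?c i) + wiener_bound n (r i) < wiener_bound n (?c i + r i - 1)"
    using i(2) assms(2,3) by (intro wiener_bound_merge(2)) auto
  with split[OF i(1)] r[OF i(1)] show "?W < wiener_bound n (n - (k - 1))" by simp
qed

lemma wiener_card_1: "card A = Suc 0 \<Longrightarrow> wiener G A = 0"
proof -
  assume "card A = Suc 0"
  then have "card e \<le> 1" if "e \<subseteq> A" for e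
    using that card_mono[of A e] card_ge_0_finite[of A] by simp
  then have "{e. e \<subseteq> A \<and> card e = 2} = {}"
    by (metis (mono_tags, lifting) Collect_empty_eq one_add_one add_le_same_cancel1 not_one_le_zero)
  then show ?thesis by (simp add: wiener_def del: Collect_empty_eq)
qed

text \<open>
  If two classes leave just as many vertices as there are other colors, these are all singletons. So
  the sizes of two classes identify the two types that matter: one large class, and two pairs.
\<close>
lemma coloring_type_two_classes:
  assumes f: "f \<in> surj_colorings k (cycle_graph n)" and ij: "i \<in> {1..k}" "j \<in> {1..k}" "i \<noteq> j"
    and sum: "card (color_class (cycle_graph n) f i) + card (color_class (cycle_graph n) f j) + (k - 2) = n"
  shows "coloring_type k (cycle_graph n) f =
    sort (card (color_class (cycle_graph n) f i) # card (color_class (cycle_graph n) f j) # replicate (k - 2) 1)"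
proof -
  let ?c = "\<lambda>j. card (color_class (cycle_graph n) f j)"
  define R where "R = {1..k} - {i} - {j}"
  have k: "{1..k} = insert i (insert j R)" and notin: "i \<notin> R" "j \<notin> R" and fin: "finite R"
    using ij by (auto simp: R_def)
  have R: "card R = k - 2" using ij by (simp add: R_def card_Diff_subset)
  have "n = ?c i + (?c j + (\<Sum>l\<in>R. ?c l))"
    using sum_card_color_class[OF f] ij sum.remove[of "{1..k}" i ?c] sum.remove[of "{1..k} - {i}" j ?c]
    by (simp add: R_def)
  with sum have "(\<Sum>l\<in>R. ?c l) = (\<Sum>l\<in>R. 1)" using R by simp
  then have one: "?c l = 1" if "l \<in> R" for l
    using that card_color_class_ge_1[OF f] fin unfolding R_def
    by (metis (mono_tags, lifting) DiffD1 order_less_irrefl le_neq_implies_less sum_strict_mono_ex1)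
  have "mset (map ?c [1..<Suc k]) = image_mset ?c (mset_set {1..k})"
    by (simp add: atLeastLessThanSuc_atLeastAtMost del: upt_Suc)
  also have "\<dots> = {# ?c i, ?c j #} + image_mset ?c (mset_set R)"
    by (subst k) (use ij notin fin in simp)
  also have "image_mset ?c (mset_set R) = image_mset (\<lambda>_. 1) (mset_set R)"
    using one fin by (intro image_mset_cong) simp
  also have "\<dots> = replicate_mset (k - 2) 1" using R by (simp add: image_mset_const_eq)
  finally have "mset (map ?c [1..<Suc k]) = mset (?c i # ?c j # replicate (k - 2) 1)" by simp
  then show ?thesis unfolding coloring_type_def by (metis sorted_list_of_multiset_mset)
qed

lemma ex_coloring_two_classes:
  assumes AB: "A \<subseteq> {0..<n}" "B \<subseteq> {0..<n}" "A \<inter> B = {}" "A \<noteq> {}" "B \<noteq> {}"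
    and k: "2 \<le> k" "card A + card B + (k - 2) = n"
  obtains g where "g \<in> surj_colorings k (cycle_graph n)"
    "coloring_type k (cycle_graph n) g = sort (card A # card B # replicate (k - 2) 1)"
    "coloring_wiener k (cycle_graph n) g = wiener (cycle_graph n) A + wiener (cycle_graph n) B"
proof -
  have fin: "finite A" "finite B" using AB finite_subset by blast+
  define R where "R = {0..<n} - (A \<union> B)"
  have "card R = n - card (A \<union> B)"
    unfolding R_def using AB fin by (subst card_Diff_subset) auto
  then have "card R = k - 2" using k AB fin by (simp add: card_Un_disjoint)
  then have "card R = card {3..k}" using k by simp
  moreover have "finite R" "finite {3..k}" by (simp_all add: R_def)
  ultimately obtain h where h: "bij_betw h R {3..k}"
    using finite_same_card_bij by blast
  define g where "g v = (if v \<in> A then 1 else if v \<in> B then 2 else if v \<in> R then h v else undefined)" for v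
  have hR: "h v \<in> {3..k}" if "v \<in> R" for v using h that by (auto simp: bij_betw_def)
  have V: "{0..<n} = A \<union> B \<union> R" using AB by (auto simp: R_def)
  have disj: "A \<inter> R = {}" "B \<inter> R = {}" by (auto simp: R_def)
  have gA: "g v = 1" if "v \<in> A" for v using that by (simp add: g_def)
  have gB: "g v = 2" if "v \<in> B" for v using that AB by (auto simp: g_def)
  have gR: "g v = h v" if "v \<in> R" for v using that disj by (auto simp: g_def)
  have gE: "g v = undefined" if "v \<notin> {0..<n}" for v using that unfolding V by (simp add: g_def)
  have ks: "{1..k} = {1, 2} \<union> {3..k}" using k by auto
  have img: "g ` {0..<n} = {1..k}"
  proof -
    have "g ` A = {1}" "g ` B = {2}" using AB gA gB by (auto simp: image_def)
    moreover have "g ` R = {3..k}" using h gR by (auto simp: bij_betw_def)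
    ultimately show ?thesis unfolding V ks by (simp only: image_Un) auto
  qed
  then have g: "g \<in> surj_colorings k (cycle_graph n)"
    using gE unfolding surj_colorings_def colorings_def by (auto simp: PiE_def extensional_def)
  have c1: "color_class (cycle_graph n) g 1 = A"
    using gA gB gR hR by (fastforce simp: color_class_def V simp del: atLeastLessThan_iff)
  have c2: "color_class (cycle_graph n) g 2 = B"
    using gA gB gR hR by (fastforce simp: color_class_def V simp del: atLeastLessThan_iff)
  have type: "coloring_type k (cycle_graph n) g = sort (card A # card B # replicate (k - 2) 1)"
    using coloring_type_two_classes[OF g, of 1 2] k unfolding c1 c2 by simp
  have "wiener (cycle_graph n) (color_class (cycle_graph n) g i) = 0" if i: "i \<in> {3..k}" for i
  proof (rule wiener_card_1)
    have "i \<in> h ` R" using h i by (simp add: bij_betw_def)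
    then obtain v where v: "v \<in> R" "h v = i" by blast
    have "color_class (cycle_graph n) g i = {v}"
    proof (intro equalityI subsetI)
      fix w assume "w \<in> color_class (cycle_graph n) g i"
      then have w: "w \<in> A \<union> B \<union> R" "g w = i" unfolding color_class_def by (auto simp: V[symmetric])
      with i gA gB have "w \<in> R" by force
      with w gR v h show "w \<in> {v}" by (auto simp: bij_betw_def inj_on_def)
    qed (use v gR V in \<open>auto simp: color_class_def\<close>)
    then show "card (color_class (cycle_graph n) g i) = Suc 0" by simp
  qed
  then have "coloring_wiener k (cycle_graph n) g = wiener (cycle_graph n) A + wiener (cycle_graph n) B"
    unfolding coloring_wiener_def ks by (subst sum.union_disjoint) (simp_all add: c1 c2 flip: One_nat_def)
  with g type show thesis by (rule that)
qed

lemma wiener_antipodal_pair: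
  assumes "u + h < 2 * h" "0 < h"
  shows "wiener (cycle_graph (2 * h)) {u, u + h} = h"
proof -
  interpret pair_graph "cycle_graph (2 * h)" by (rule pair_graph_cycle_graph)
  have "graph_dist (cycle_graph (2 * h)) u (u + h) = h"
    using graph_dist_cycle_graph[of u "u + h" "2 * h"] assms by simp
  moreover have "{e. e \<subseteq> {u, u + h} \<and> card e = 2} = {{u, u + h}}"
  proof (intro equalityI subsetI)
    fix e assume "e \<in> {e. e \<subseteq> {u, u + h} \<and> card e = 2}"
    then have "e = {u, u + h}" using assms by (intro card_subset_eq) auto
    then show "e \<in> {{u, u + h}}" by simp
  qed (use assms in auto)
  moreover have "(THE d. \<forall>x y. {u, u + h} = {x, y} \<longrightarrow> d = graph_dist (cycle_graph (2 * h)) x y) =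
      graph_dist (cycle_graph (2 * h)) u (u + h)"
    by (rule the_equality) (auto simp: doubleton_eq_iff graph_dist_commute)
  ultimately show ?thesis by (simp add: wiener_def)
qed

theorem corollary4p12:
  fixes n k :: nat and f :: "nat \<Rightarrow> nat"
  assumes "2 \<le> k" and "k \<le> n"
    and "f \<in> weak_maximizers k (cycle_graph n)"
  shows "(even n \<and> n - k \<le> 2 \<longrightarrow>
            coloring_wiener k (cycle_graph n) f =
              Max (coloring_wiener k (cycle_graph n) ` weak_maximizers k (cycle_graph n))) \<and>
         (odd n \<or> n - k > 2 \<longrightarrow>
            (coloring_wiener k (cycle_graph n) f =
              Max (coloring_wiener k (cycle_graph n) ` weak_maximizers k (cycle_graph n)) \<longleftrightarrow>
             (\<exists>i \<in> {1..k}. card (color_class (cycle_graph n) f i) = n - (k - 1))))"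
proof -
  let ?G = "cycle_graph n" and ?m = "n - (k - 1)"
  let ?W = "coloring_wiener k ?G" and ?S = "surj_colorings k ?G" and ?c = "\<lambda>i. card (color_class ?G f i)"
  have f: "f \<in> ?S" using assms(3) by (simp add: weak_maximizers_def)
  have max: "?W g \<le> ?W f" if "g \<in> ?S" "coloring_type k ?G g = coloring_type k ?G f" for g
    using assms(3) that by (simp add: weak_maximizers_def)
  have up: "8 * int (?W g) \<le> wiener_bound n ?m" if "g \<in> ?S" for g
    by (rule coloring_wiener_le_concentrated(1)[OF that assms(1,2)])
  have m: "1 \<le> ?m" "?m < n" using assms(1,2) by auto
  have card_spread_m: "card (spread n ?m) = ?m" by (rule card_spread) simp
  have sub: "spread n ?m \<subseteq> {0..<n}" by (auto simp: spread_def)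
  \<comment> \<open>As \<open>k \<ge> 2\<close>, there is a vertex outside the spread set; it serves as the second class.\<close>
  have "spread n ?m \<noteq> {0..<n}"
    using card_spread_m m by (metis card_atLeastLessThan diff_zero less_irrefl)
  then obtain v where v: "v < n" "v \<notin> spread n ?m" using sub by fastforce
  have "spread n ?m \<noteq> {}" using card_spread_m m by force
  then obtain g where g: "g \<in> ?S"
      and type_g: "coloring_type k ?G g = sort (?m # 1 # replicate (k - 2) 1)"
      and W_g: "?W g = wiener ?G (spread n ?m) + wiener ?G {v}"
    using ex_coloring_two_classes[of "spread n ?m" n "{v}" k] sub v assms(1,2) card_spread_m by auto
  have top_g: "8 * int (?W g) = wiener_bound n ?m"
    using wiener_spread[of ?m n] unfolding W_g by (simp add: wiener_card_1)
  have "finite ?S"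
    by (rule finite_subset[of _ "{0..<n} \<rightarrow>\<^sub>E {1..k}"])
      (auto simp: surj_colorings_def colorings_def intro: finite_PiE)
  then have "finite (weak_maximizers k ?G)" by (simp add: weak_maximizers_def)
  moreover have "g \<in> weak_maximizers k ?G"
    using g up top_g by (force simp: weak_maximizers_def)
  moreover have "?W g' \<le> ?W g" if "g' \<in> weak_maximizers k ?G" for g'
    using up[of g'] top_g that by (simp add: weak_maximizers_def)
  ultimately have Max: "Max (?W ` weak_maximizers k ?G) = ?W g"
    by (intro Max_eqI) auto
  have optimal_iff: "?W f = Max (?W ` weak_maximizers k ?G) \<longleftrightarrow> 8 * int (?W f) = wiener_bound n ?m"
    unfolding Max using top_g by linarith
  have big: "8 * int (?W f) = wiener_bound n ?m" if i: "i \<in> {1..k}" and ci: "?c i = ?m" for i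
  proof -
    obtain j where j: "j \<in> {1..k}" "i \<noteq> j"
      using assms(1) i by (cases "i = 1") (auto intro: that[of 1] that[of 2])
    have "(\<Sum>l\<in>{1..k} - {i}. ?c l - 1) = 0"
      using card_color_class_complement(2)[OF f i] ci assms(1,2) by linarith
    then have "\<forall>l\<in>{1..k} - {i}. ?c l - 1 = 0" by (simp only: sum_eq_0_iff finite_Diff finite_atLeastAtMost)
    then have "?c j - 1 = 0" using j by blast
    then have "?c j = 1" using card_color_class_ge_1[OF f j(1)] by simp
    with ci assms(1,2) have "coloring_type k ?G f = coloring_type k ?G g"
      using coloring_type_two_classes[OF f i j] unfolding type_g by simp
    with max[OF g] up[OF f] top_g show ?thesis by simp
  qed
  have "8 * int (?W f) = wiener_bound n ?m" if n: "even n" "n - k \<le> 2"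
  proof (cases "\<exists>i\<in>{1..k}. ?c i = ?m")
    case True
    with big show ?thesis by blast
  next
    case False
    then have small: "?c i \<le> n - k" if "i \<in> {1..k}" for i
      using card_color_class_complement(1)[OF f that] that assms(1,2) by force
    have one: "1 \<in> {1..k}" using assms(1) by simp
    have "n \<noteq> k" using small[OF one] card_color_class_ge_1[OF f one] by auto
    then have "\<exists>i\<in>{1..k}. 2 \<le> ?c i"
      using ex_card_color_class_ge_2[OF f] assms(2) by simp
    then obtain i where i: "i \<in> {1..k}" "2 \<le> ?c i" by blast
    with small[OF i(1)] n have nk: "n = k + 2" and ci: "?c i = 2" by linarith+
    have "\<exists>j\<in>{1..k} - {i}. ?c j - 1 \<noteq> 0"
    proof (rule ccontr)
      assume "\<not> ?thesis"
      then have "(\<Sum>l\<in>{1..k} - {i}. ?c l - 1) = 0" by simp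
      with card_color_class_complement(2)[OF f i(1)] ci nk assms(1) show False by simp
    qed
    then obtain j where j: "j \<in> {1..k}" "i \<noteq> j" "2 \<le> ?c j" by force
    with small[OF j(1)] nk have cj: "?c j = 2" by simp
    \<comment> \<open>All other classes are singletons, so \<open>f\<close> has the type of a coloring with two antipodal pairs.\<close>
    obtain h where h: "n = 2 * h" using n by auto
    with nk assms(1) have "2 \<le> h" by simp
    have pairs: "card {0, 0 + h} = 2" "card {1, 1 + h} = 2" "{0, 0 + h} \<inter> {1, 1 + h} = {}"
        "{0, 0 + h} \<subseteq> {0..<n}" "{1, 1 + h} \<subseteq> {0..<n}"
      using \<open>2 \<le> h\<close> h by auto
    have "2 + 2 + (k - 2) = n" using nk assms(1) by simp
    then obtain g' where g': "g' \<in> ?S"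
        and type_g': "coloring_type k ?G g' = sort (2 # 2 # replicate (k - 2) 1)"
        and W_g': "?W g' = wiener ?G {0, 0 + h} + wiener ?G {1, 1 + h}"
      using ex_coloring_two_classes[OF pairs(4,5,3) insert_not_empty insert_not_empty assms(1)]
      unfolding pairs(1,2) by blast
    have "?W g' = 2 * h"
      using \<open>2 \<le> h\<close> wiener_antipodal_pair[of 0 h] wiener_antipodal_pair[of 1 h] W_g'
      by (simp add: h)
    moreover have "wiener_bound n ?m = 8 * int n"
      using nk assms(1) by (simp add: wiener_bound_def)
    moreover have "coloring_type k ?G g' = coloring_type k ?G f"
      using coloring_type_two_classes[OF f i(1) j(1,2)] ci cj nk assms(1) unfolding type_g' by simp
    ultimately show ?thesis using max[OF g'] up[OF f] h by simp
  qed
  moreover have "8 * int (?W f) = wiener_bound n ?m \<longleftrightarrow> (\<exists>i\<in>{1..k}. ?c i = ?m)"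
    if "odd n \<or> 2 < n - k"
    using big coloring_wiener_le_concentrated(2)[OF f assms(1,2) _ that] by fastforce
  ultimately show ?thesis unfolding optimal_iff by blast
qed

end
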